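(* Let $S$ be a semigroup of order $n\in\mathbb{N}$. Then the following statements are equivalent: \begin{enumerate} \item[(i)] $S$ is nilpotent of coclass $0$; \item[(ii)] $S$ is monogenic and nilpotent; \item[(iii)] $S$ is monogenic with period $1$; \item[(iv)] $\langle u\mid u^n=u^{n+1}\rangle$ is a presentation for $S$. \end{enumerate}
   Context: A semigroup $S$ is nilpotent if there exists $c\in\mathbb{N}_0$ with $|S^{c+1}|=1$, where $S^k$ denotes the set of all products of $k$ elements of $S$; the least such $c$ is the class of $S$. The coclass of a finite nilpotent semigroup $S$ of class $c$ is $|S|-1-c$. A finite semigroup generated by a single element $u$ which satisfies $u^k=u^{k+l}$ for minimal $k,l\in\mathbb{N}=\{1,2,\dots\}$ is called monogenic of index $k$ and period $l$. Presentations are semigroup presentations. *)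

theory Defs
  imports Main
begin

section \<open>Semigroups on a carrier set\<close>

locale semigroup_on =
  fixes S :: "'a set" and f :: "'a \<Rightarrow> 'a \<Rightarrow> 'a"
  assumes closed: "x \<in> S \<Longrightarrow> y \<in> S \<Longrightarrow> f x y \<in> S"
    and assoc: "x \<in> S \<Longrightarrow> y \<in> S \<Longrightarrow> z \<in> S \<Longrightarrow> f (f x y) z = f x (f y z)"

text \<open>A semigroup has no empty product: \<open>sg_prod f []\<close> is unspecified, and hence
  \<open>sg_power f u k\<close> and \<open>set_power S f k\<close> are only meaningful for \<open>k \<ge> 1\<close>.\<close>

fun sg_prod :: "('a \<Rightarrow> 'a \<Rightarrow> 'a) \<Rightarrow> 'a list \<Rightarrow> 'a" where
  "sg_prod f [] = undefined"
| "sg_prod f [x] = x"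
| "sg_prod f (x # y # xs) = f x (sg_prod f (y # xs))"

definition sg_power :: "('a \<Rightarrow> 'a \<Rightarrow> 'a) \<Rightarrow> 'a \<Rightarrow> nat \<Rightarrow> 'a" where
  "sg_power f u k = sg_prod f (replicate k u)"

definition set_power :: "'a set \<Rightarrow> ('a \<Rightarrow> 'a \<Rightarrow> 'a) \<Rightarrow> nat \<Rightarrow> 'a set" where
  "set_power S f k = {sg_prod f xs | xs. set xs \<subseteq> S \<and> length xs = k}"

inductive_set generated :: "('a \<Rightarrow> 'a \<Rightarrow> 'a) \<Rightarrow> 'a set \<Rightarrow> 'a set"
  for f :: "'a \<Rightarrow> 'a \<Rightarrow> 'a" and A :: "'a set" where
  base: "a \<in> A \<Longrightarrow> a \<in> generated f A"
| mult: "x \<in> generated f A \<Longrightarrow> y \<in> generated f A \<Longrightarrow> f x y \<in> generated f A"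

definition sg_isomorphic ::
    "'a set \<Rightarrow> ('a \<Rightarrow> 'a \<Rightarrow> 'a) \<Rightarrow> 'b set \<Rightarrow> ('b \<Rightarrow> 'b \<Rightarrow> 'b) \<Rightarrow> bool" where
  "sg_isomorphic S f T g \<longleftrightarrow>
    (\<exists>\<phi>. bij_betw \<phi> S T \<and> (\<forall>x\<in>S. \<forall>y\<in>S. \<phi> (f x y) = g (\<phi> x) (\<phi> y)))"

section \<open>Nilpotency, class and coclass\<close>

definition nilpotent :: "'a set \<Rightarrow> ('a \<Rightarrow> 'a \<Rightarrow> 'a) \<Rightarrow> bool" where
  "nilpotent S f \<longleftrightarrow> (\<exists>c. card (set_power S f (c + 1)) = 1)"

definition nilpotency_class :: "'a set \<Rightarrow> ('a \<Rightarrow> 'a \<Rightarrow> 'a) \<Rightarrow> nat" where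
  "nilpotency_class S f = (LEAST c. card (set_power S f (c + 1)) = 1)"

text \<open>Integer-valued, so that no truncated subtraction is involved.\<close>

definition coclass :: "'a set \<Rightarrow> ('a \<Rightarrow> 'a \<Rightarrow> 'a) \<Rightarrow> int" where
  "coclass S f = int (card S) - 1 - int (nilpotency_class S f)"

section \<open>Monogenic semigroups\<close>

definition monogenic_index_period ::
    "'a set \<Rightarrow> ('a \<Rightarrow> 'a \<Rightarrow> 'a) \<Rightarrow> nat \<Rightarrow> nat \<Rightarrow> bool" where
  "monogenic_index_period S f k l \<longleftrightarrow>
    finite S \<and>
    (\<exists>u. S = generated f {u} \<and>
      1 \<le> k \<and> 1 \<le> l \<and> sg_power f u k = sg_power f u (k + l) \<and>
      (\<forall>k' l'. 1 \<le> k' \<and> 1 \<le> l' \<and> sg_power f u k' = sg_power f u (k' + l')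
         \<longrightarrow> k \<le> k' \<and> l \<le> l'))"

definition monogenic :: "'a set \<Rightarrow> ('a \<Rightarrow> 'a \<Rightarrow> 'a) \<Rightarrow> bool" where
  "monogenic S f \<longleftrightarrow> (\<exists>k l. monogenic_index_period S f k l)"

definition monogenic_period :: "'a set \<Rightarrow> ('a \<Rightarrow> 'a \<Rightarrow> 'a) \<Rightarrow> nat \<Rightarrow> bool" where
  "monogenic_period S f l \<longleftrightarrow> (\<exists>k. monogenic_index_period S f k l)"

section \<open>Semigroup presentations\<close>

text \<open>The free semigroup on \<open>X\<close> consists of the nonempty words over \<open>X\<close>, with concatenation.\<close>

definition free_semigroup :: "'x set \<Rightarrow> 'x list set" where
  "free_semigroup X = lists X - {[]}"

definition congruence_on :: "'a set \<Rightarrow> ('a \<Rightarrow> 'a \<Rightarrow> 'a) \<Rightarrow> ('a \<times> 'a) set \<Rightarrow> bool" where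
  "congruence_on S f r \<longleftrightarrow>
    equiv S r \<and>
    (\<forall>a b c d. (a, b) \<in> r \<longrightarrow> (c, d) \<in> r \<longrightarrow> (f a c, f b d) \<in> r)"

definition generated_congruence ::
    "'a set \<Rightarrow> ('a \<Rightarrow> 'a \<Rightarrow> 'a) \<Rightarrow> ('a \<times> 'a) set \<Rightarrow> ('a \<times> 'a) set" where
  "generated_congruence S f R = \<Inter>{r. congruence_on S f r \<and> R \<subseteq> r}"

text \<open>The union below consists of equal sets when \<open>r\<close> is a congruence and \<open>A\<close>, \<open>B\<close> are
  \<open>r\<close>-classes, so it is the class of \<open>f a b\<close> for any \<open>a \<in> A\<close>, \<open>b \<in> B\<close>.\<close>

definition quotient_mult ::
    "('a \<Rightarrow> 'a \<Rightarrow> 'a) \<Rightarrow> ('a \<times> 'a) set \<Rightarrow> 'a set \<Rightarrow> 'a set \<Rightarrow> 'a set" where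
  "quotient_mult f r A B = (\<Union>a\<in>A. \<Union>b\<in>B. r `` {f a b})"

text \<open>A relation \<open>v = w\<close> of a presentation is the pair \<open>(v, w)\<close> of nonempty words.\<close>

definition is_presentation ::
    "'x set \<Rightarrow> ('x list \<times> 'x list) set \<Rightarrow> 'a set \<Rightarrow> ('a \<Rightarrow> 'a \<Rightarrow> 'a) \<Rightarrow> bool" where
  "is_presentation X R S f \<longleftrightarrow>
    R \<subseteq> free_semigroup X \<times> free_semigroup X \<and>
    (let \<rho> = generated_congruence (free_semigroup X) (@) R
     in sg_isomorphic S f (free_semigroup X // \<rho>) (quotient_mult (@) \<rho>))"

end

theory Submission
  imports Defs
begin

text \<open>
  All four conditions say that \<open>S = {v, v\<^sup>2, \<dots>, v\<^sup>n}\<close> with distinct powers and \<open>v\<^sup>n = v\<^sup>n\<^sup>+\<^sup>1\<close>.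
  A generator \<open>v\<close> has this property as soon as \<open>v\<^sup>m = v\<^sup>m\<^sup>+\<^sup>1\<close> for some \<open>m\<close>, which nilpotency
  implies. If the coclass is \<open>0\<close>, then each step of the chain \<open>S \<supset> S\<^sup>2 \<supset> S\<^sup>3 \<supset> \<dots>\<close> loses
  exactly one element, and the element \<open>v\<close> lost in the first step generates \<open>S\<close>. For the
  presentation, the words \<open>u\<^sup>i\<close> and \<open>u\<^sup>j\<close> are congruent iff \<open>min i n = min j n\<close>, so the
  quotient is \<open>{1..n}\<close> under truncated addition, and the same holds for \<open>S\<close>.
\<close>

section \<open>Isomorphisms\<close>

lemma sg_isomorphic_sym:
  assumes iso: "sg_isomorphic S f T g"
    and closed: "\<And>x y. x \<in> S \<Longrightarrow> y \<in> S \<Longrightarrow> f x y \<in> S"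
  shows "sg_isomorphic T g S f"
proof -
  obtain h where h: "bij_betw h S T" "\<And>x y. x \<in> S \<Longrightarrow> y \<in> S \<Longrightarrow> h (f x y) = g (h x) (h y)"
    using iso unfolding sg_isomorphic_def by blast
  have "inv_into S h (g a b) = f (inv_into S h a) (inv_into S h b)" if "a \<in> T" "b \<in> T" for a b
  proof -
    have inS: "inv_into S h a \<in> S" "inv_into S h b \<in> S"
      using that h(1) bij_betw_inv_into bij_betwE by metis+
    then have "h (f (inv_into S h a) (inv_into S h b)) = g a b"
      using that h by (simp add: bij_betw_inv_into_right)
    \<comment> \<open>Closure places the product in \<open>S\<close>, where
      \<open>inv_into S h\<close> cancels \<open>h\<close>.\<close>
    then show ?thesis
      using closed[OF inS] h(1) by (metis bij_betw_inv_into_left)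
  qed
  then show ?thesis
    unfolding sg_isomorphic_def using bij_betw_inv_into[OF h(1)] by blast
qed

lemma sg_isomorphic_trans:
  assumes "sg_isomorphic S f T g" and "sg_isomorphic T g U h"
  shows "sg_isomorphic S f U h"
proof -
  obtain p where p: "bij_betw p S T" "\<And>x y. x \<in> S \<Longrightarrow> y \<in> S \<Longrightarrow> p (f x y) = g (p x) (p y)"
    using assms(1) unfolding sg_isomorphic_def by blast
  obtain q where q: "bij_betw q T U" "\<And>x y. x \<in> T \<Longrightarrow> y \<in> T \<Longrightarrow> q (g x y) = h (q x) (q y)"
    using assms(2) unfolding sg_isomorphic_def by blast
  show ?thesis
    unfolding sg_isomorphic_def
    using bij_betw_trans[OF p(1) q(1)] p(2) q(2) bij_betwE[OF p(1)]
    by (intro exI[of _ "q \<circ> p"]) simp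
qed

section \<open>Powers of an element and of a semigroup\<close>

lemma sg_power_1 [simp]: "sg_power f u (Suc 0) = u"
  by (simp add: sg_power_def)

lemma sg_power_Suc: "k \<ge> 1 \<Longrightarrow> sg_power f u (Suc k) = f u (sg_power f u k)"
  by (cases k) (simp_all add: sg_power_def)

lemma set_power_1 [simp]: "set_power S f (Suc 0) = S"
proof -
  have "x \<in> set_power S f (Suc 0)" if "x \<in> S" for x
    unfolding set_power_def using that by (intro CollectI exI[of _ "[x]"]) simp
  then show ?thesis
    by (auto simp: set_power_def length_Suc_conv)
qed

lemma sg_prod_Cons: "xs \<noteq> [] \<Longrightarrow> sg_prod f (x # xs) = f x (sg_prod f xs)"
  by (cases xs) simp_all

lemma set_power_Suc:
  assumes "k \<ge> 1"
  shows "set_power S f (Suc k) = {f x y | x y. x \<in> S \<and> y \<in> set_power S f k}"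
proof (intro equalityI subsetI)
  fix z assume "z \<in> set_power S f (Suc k)"
  then obtain x xs where "z = sg_prod f (x # xs)" "x \<in> S" "set xs \<subseteq> S" "length xs = k"
    unfolding set_power_def by (auto simp: length_Suc_conv)
  moreover from this have "xs \<noteq> []" using assms by auto
  ultimately show "z \<in> {f x y | x y. x \<in> S \<and> y \<in> set_power S f k}"
    by (auto simp: set_power_def sg_prod_Cons)
next
  fix z assume "z \<in> {f x y | x y. x \<in> S \<and> y \<in> set_power S f k}"
  then obtain x xs where *: "z = f x (sg_prod f xs)" "x \<in> S" "set xs \<subseteq> S" "length xs = k"
    unfolding set_power_def by blast
  moreover from this have "xs \<noteq> []" using assms by auto
  ultimately show "z \<in> set_power S f (Suc k)"
    unfolding set_power_def by (intro CollectI exI[of _ "x # xs"]) (simp add: sg_prod_Cons)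
qed

lemma sg_power_in_set_power: "u \<in> S \<Longrightarrow> sg_power f u k \<in> set_power S f k"
  unfolding set_power_def sg_power_def by (auto intro!: exI[of _ "replicate k u"])

text \<open>Multiplying by \<open>S\<close> on the left turns an equality of two consecutive powers
  into the next such equality, so the sequence of powers is constant from its first repetition
  on.\<close>

lemma set_power_stable:
  assumes "k \<ge> 1" and "set_power S f (Suc k) = set_power S f k"
  shows "set_power S f (k + j) = set_power S f k"
proof (induction j)
  case (Suc j)
  have "set_power S f (Suc (k + j)) = set_power S f (Suc k)"
    using assms(1) Suc by (simp add: set_power_Suc)
  then show ?case using assms(2) by simp
qed simp

lemma least_nilpotency_class:
  assumes "nilpotent S f"
  shows "card (set_power S f (nilpotency_class S f + 1)) = 1"
    and "j < nilpotency_class S f \<Longrightarrow> card (set_power S f (j + 1)) \<noteq> 1"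
  using assms LeastI_ex[of "\<lambda>c. card (set_power S f (c + 1)) = 1"]
    not_less_Least[of _ "\<lambda>c. card (set_power S f (c + 1)) = 1"]
  unfolding nilpotent_def nilpotency_class_def by blast+

context semigroup_on
begin

section \<open>Exponent laws, generated subsemigroup and descending chain of powers\<close>

lemma power_in:
  assumes "u \<in> S" and "k \<ge> 1"
  shows "sg_power f u k \<in> S"
  using assms(2)
proof (induction k rule: dec_induct)
  case (step k)
  then show ?case using assms(1) by (simp add: sg_power_Suc closed)
qed (simp add: assms(1))

lemma power_add:
  assumes "u \<in> S" and "i \<ge> 1" and "j \<ge> 1"
  shows "sg_power f u (i + j) = f (sg_power f u i) (sg_power f u j)"
  using assms(2)
proof (induction i rule: dec_induct)
  case base
  then show ?case using assms by (simp add: sg_power_Suc)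
next
  case (step i)
  then show ?case using assms by (simp add: sg_power_Suc assoc power_in)
qed

lemma power_period:
  assumes "u \<in> S" and "i \<ge> 1" and "sg_power f u i = sg_power f u (i + l)"
  shows "sg_power f u i = sg_power f u (i + t * l)"
proof (induction t)
  case (Suc t)
  show ?case
  \<comment> \<open>\<open>power_add\<close> requires positive exponents, since
    \<open>sg_power f u 0\<close> is unspecified; a vanishing multiple is therefore treated
    separately.\<close>
  proof (cases "t * l = 0")
    case True
    then show ?thesis using assms by auto
  next
    case False
    then have "sg_power f u (i + l + t * l) = sg_power f u (i + t * l)"
      using assms power_add[of u "i + l" "t * l"] power_add[of u i "t * l"] by simp
    then show ?thesis using Suc by (simp add: algebra_simps)
  qed
qed simp

lemma power_absorb:
  assumes "u \<in> S" and "m \<ge> 1" and "sg_power f u m = sg_power f u (Suc m)" and "i \<ge> m"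
  shows "sg_power f u i = sg_power f u m"
  using power_period[of u m 1 "i - m"] assms by simp

lemma generated_singleton:
  assumes "u \<in> S"
  shows "generated f {u} = sg_power f u ` {1..}"
proof (intro equalityI subsetI)
  fix x assume "x \<in> generated f {u}"
  then show "x \<in> sg_power f u ` {1..}"
  proof induction
    case (base a)
    then show ?case by (auto intro!: image_eqI[of _ _ 1])
  next
    case (mult x y)
    then obtain i j where "x = sg_power f u i" "y = sg_power f u j" "i \<ge> 1" "j \<ge> 1"
      by auto
    then show ?case
      using assms by (auto intro!: image_eqI[of _ _ "i + j"] simp: power_add)
  qed
next
  have "sg_power f u k \<in> generated f {u}" if "k \<ge> 1" for k
    using that
  proof (induction k rule: dec_induct)
    case base
    show ?case by (simp add: generated.base)
  next
    case (step k)
    then show ?case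
      by (simp add: sg_power_Suc generated.base generated.mult)
  qed
  then show "x \<in> generated f {u}" if "x \<in> sg_power f u ` {1..}" for x
    using that by auto
qed

lemma set_power_Suc_subset:
  assumes "k \<ge> 1"
  shows "set_power S f (Suc k) \<subseteq> set_power S f k"
  using assms
proof (induction k rule: dec_induct)
  case base
  then show ?case by (auto simp: set_power_Suc closed)
next
  case (step k)
  then show ?case unfolding set_power_Suc[OF step(1)] set_power_Suc[OF le_SucI[OF step(1)]]
    by blast
qed

text \<open>The singleton S^(c+1) contains u^(c+1), and also u^(c+2) because the powers of
  \<open>S\<close> descend.\<close>

lemma nilpotent_power_stable:
  assumes "nilpotent S f" and "u \<in> S"
  obtains m where "m \<ge> 1" and "sg_power f u m = sg_power f u (Suc m)"
proof -
  obtain c z where "set_power S f (Suc c) = {z}"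
    using assms(1) by (auto simp: nilpotent_def card_1_singleton_iff)
  moreover have "sg_power f u (Suc (Suc c)) \<in> set_power S f (Suc c)"
    using sg_power_in_set_power[OF assms(2)] set_power_Suc_subset[of "Suc c"] by auto
  ultimately have "sg_power f u (Suc c) = sg_power f u (Suc (Suc c))"
    using sg_power_in_set_power[OF assms(2), of f "Suc c"] by auto
  then show ?thesis using that[of "Suc c"] by simp
qed

section \<open>The coclass zero condition\<close>

text \<open>An equality at step \<open>k\<close> would freeze the chain there, making S^k equal to
  the final singleton; then \<open>k - 1\<close> would already witness nilpotency, against the
  minimality of the class.\<close>

lemma set_power_strict:
  assumes "nilpotent S f" and "1 \<le> k" and "k \<le> nilpotency_class S f"
  shows "set_power S f (Suc k) \<subset> set_power S f k"
proof -
  have "set_power S f (Suc k) \<noteq> set_power S f k"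
  proof
    assume "set_power S f (Suc k) = set_power S f k"
    then have "set_power S f (k + (nilpotency_class S f + 1 - k)) = set_power S f k"
      using assms(2) set_power_stable by blast
    then have "card (set_power S f (k - 1 + 1)) = 1"
      using least_nilpotency_class(1)[OF assms(1)] assms(2,3) by simp
    moreover have "k - 1 < nilpotency_class S f"
      using assms(2,3) by linarith
    ultimately show False
      using least_nilpotency_class(2)[OF assms(1)] by blast
  qed
  then show ?thesis using set_power_Suc_subset[OF assms(2)] by blast
qed

lemma set_power_subset:
  assumes "k \<ge> 1"
  shows "set_power S f k \<subseteq> S"
  using assms
proof (induction k rule: dec_induct)
  case (step k)
  then show ?case using set_power_Suc_subset[of k] by simp
qed simp

text \<open>In a product of \<open>x\<close> from \<open>S\<close> and \<open>y\<close> from S^k,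
  either both factors are the exceptional ones, \<open>u\<close> and u^k, or one of them can be
  written with one more factor, which puts the product into S^(k+2).\<close>

lemma set_power_split:
  assumes u: "u \<in> S" and S: "S \<subseteq> insert u (set_power S f 2)" and "k \<ge> 1"
  shows "set_power S f k \<subseteq> insert (sg_power f u k) (set_power S f (Suc k))"
  using assms(3)
proof (induction k rule: dec_induct)
  case base
  then show ?case using S by (simp add: numeral_2_eq_2)
next
  case (step k)
  show ?case
  proof
    fix z assume "z \<in> set_power S f (Suc k)"
    then obtain x y where z: "z = f x y" and x: "x \<in> S" and y: "y \<in> set_power S f k"
      using step(1) by (auto simp: set_power_Suc)
    have "y \<in> S" using y step(1) set_power_subset by blast
    consider "y \<in> set_power S f (Suc k)" | "x = u" "y = sg_power f u k" | "x \<in> set_power S f 2"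
      using step y S x by blast
    then show "z \<in> insert (sg_power f u (Suc k)) (set_power S f (Suc (Suc k)))"
    proof cases
      case 1
      then show ?thesis using z x set_power_Suc[of "Suc k" S f] by auto
    next
      case 2
      then show ?thesis using z step(1) by (simp add: sg_power_Suc)
    next
      case 3
      then obtain a b where "x = f a b" "a \<in> S" "b \<in> S"
        by (auto simp: numeral_2_eq_2 set_power_Suc)
      \<comment> \<open>Rebracketing (ab)y as a(by) moves the extra factor of \<open>x\<close> over
        to \<open>y\<close>.\<close>
      then have "z = f a (f b y)" "f b y \<in> set_power S f (Suc k)"
        using z y \<open>y \<in> S\<close> step(1) set_power_Suc[of k S f] by (auto simp: assoc)
      then show ?thesis using \<open>a \<in> S\<close> set_power_Suc[of "Suc k" S f] by auto
    qed
  qed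
qed

text \<open>With |S| = c + 1 there is room for the \<open>c\<close> strict inclusions down to the
  singleton S^(c+1) only if each of them drops a single element.\<close>

lemma coclass_0_generator:
  assumes fin: "finite S" and nil: "nilpotent S f" and "coclass S f = 0"
  obtains u where "u \<in> S" and "S = generated f {u}"
proof -
  define c where "c = nilpotency_class S f"
  have card_S: "card S = Suc c"
    using assms(3) by (simp add: coclass_def c_def)
  have last: "card (set_power S f (Suc c)) = 1"
    using least_nilpotency_class(1)[OF nil] by (simp add: c_def)
  have fin_pow: "finite (set_power S f k)" if "k \<ge> 1" for k
    using set_power_subset[OF that] fin finite_subset by blast
  have strict: "card (set_power S f (Suc k)) < card (set_power S f k)" if "1 \<le> k" "k \<le> c" for k
    using set_power_strict[OF nil, of k] that fin_pow by (simp add: c_def psubset_card_mono)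
  \<comment> \<open>A covering rather than a statement about the difference, because for
    \<open>c = 0\<close> the set \<open>S\<close> is a singleton equal to its square and nothing is
    lost.\<close>
  have "\<exists>u\<in>S. S \<subseteq> insert u (set_power S f 2)"
  proof (cases "c = 0")
    case True
    then show ?thesis using card_S by (auto simp: card_1_singleton_iff)
  next
    case False
    \<comment> \<open>Counting upwards from the singleton S^(c+1), each step adds at least one
      element. At \<open>j = c - 1\<close> this reaches S^2, which thus has at least
      \<open>c\<close> of the c + 1 elements of \<open>S\<close>.\<close>
    have "card (set_power S f (Suc c - j)) \<ge> Suc j" if "j \<le> c" for j
      using that
    proof (induction j)
      case 0
      then show ?case using last by simp
    next
      case (Suc j)
      then have "Suc c - j = Suc (Suc c - Suc j)" by simp
      moreover have "1 \<le> Suc c - Suc j" "Suc c - Suc j \<le> c"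
        using Suc.prems by linarith+
      ultimately show ?case
        using Suc.IH Suc.prems strict[of "Suc c - Suc j"] by (metis Suc_leD le_less_trans Suc_leI)
    qed
    from this[of "c - 1"] have "card (set_power S f 2) \<ge> c"
      using False by (simp add: numeral_2_eq_2 Suc_diff_le)
    moreover have "card (set_power S f 2) < Suc c"
      using strict[of 1] False card_S by (simp add: numeral_2_eq_2)
    ultimately have "card (S - set_power S f 2) = 1"
      using card_S set_power_subset[of 2] fin_pow[of 2] by (simp add: card_Diff_subset)
    then show ?thesis by (auto simp: card_1_singleton_iff)
  qed
  then obtain u where u: "u \<in> S" "S \<subseteq> insert u (set_power S f 2)" by blast
  have cover: "S \<subseteq> sg_power f u ` {1..} \<union> set_power S f k" if "k \<ge> 1" for k
    using that
  proof (induction k rule: dec_induct)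
    case (step k)
    then show ?case using set_power_split[OF u step(1)] by auto
  qed simp
  \<comment> \<open>At exponent c + 1 the part of \<open>cover\<close> outside the powers of
    \<open>u\<close> is a singleton, and its element is itself a power of \<open>u\<close>.\<close>
  have "sg_power f u (Suc c) \<in> set_power S f (Suc c)"
    using u(1) by (rule sg_power_in_set_power)
  then have "set_power S f (Suc c) = {sg_power f u (Suc c)}"
    using last by (auto simp: card_1_singleton_iff)
  then have "S \<subseteq> sg_power f u ` {1..}"
    using cover[of "Suc c"] by auto
  then have "S = generated f {u}"
    using generated_singleton[OF u(1)] power_in[OF u(1)] by auto
  then show ?thesis using that u(1) by blast
qed

section \<open>Truncated cyclic semigroups\<close>

text \<open>The common form to which all four conditions are reduced. Keeping \<open>n\<close>
  explicit lets the exponents 1 to \<open>n\<close> serve as coordinates on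
  \<open>S\<close>.\<close>

definition nil_generator :: "'a \<Rightarrow> nat \<Rightarrow> bool" where
  "nil_generator v n \<longleftrightarrow> v \<in> S \<and> n \<ge> 1 \<and> bij_betw (sg_power f v) {1..n} S
     \<and> sg_power f v n = sg_power f v (Suc n)"

text \<open>Let \<open>k\<close> be the least exponent at which the powers become stationary. A
  repetition among the first \<open>k\<close> powers would force them to be stationary before
  \<open>k\<close>.\<close>

lemma nil_generatorI:
  assumes u: "u \<in> S" and gen: "S = generated f {u}"
    and m: "m \<ge> 1" "sg_power f u m = sg_power f u (Suc m)"
  shows "nil_generator u (card S)"
proof -
  define k where "k = (LEAST k. k \<ge> 1 \<and> sg_power f u k = sg_power f u (Suc k))"
  have k: "k \<ge> 1" "sg_power f u k = sg_power f u (Suc k)"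
    using LeastI[of "\<lambda>k. k \<ge> 1 \<and> sg_power f u k = sg_power f u (Suc k)" m] m
    by (simp_all add: k_def)
  have least: "k \<le> i" if "i \<ge> 1" "sg_power f u i = sg_power f u (Suc i)" for i
    unfolding k_def using that by (simp add: Least_le)
  have "sg_power f u i \<noteq> sg_power f u j" if "1 \<le> i" "i < j" "j \<le> k" for i j
  proof
    assume eq: "sg_power f u i = sg_power f u j"
    \<comment> \<open>As \<open>j - i\<close> is positive, repeating this period \<open>m\<close>
      times pushes the exponent to at least \<open>m\<close>, where all powers coincide.\<close>
    have "sg_power f u i = sg_power f u (i + m * (j - i))"
      using power_period[of u i "j - i" m] u that eq by simp
    moreover have "m \<le> i + m * (j - i)"
    proof -
      have "m * 1 \<le> m * (j - i)"
        using that by (intro mult_le_mono2) linarith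
      then show ?thesis by linarith
    qed
    ultimately have i: "sg_power f u i = sg_power f u m"
      using power_absorb[OF u m] by metis
    then have "sg_power f u (Suc i) = sg_power f u (Suc m)"
      using that(1) m(1) by (simp add: sg_power_Suc)
    then have "sg_power f u i = sg_power f u (Suc i)"
      using i m(2) by argo
    then have "k \<le> i" using that(1) by (intro least)
    then show False using that by linarith
  qed
  then have inj: "inj_on (sg_power f u) {1..k}"
    by (intro linorder_inj_onI') auto
  have "sg_power f u i \<in> sg_power f u ` {1..k}" if "i \<ge> 1" for i
    using power_absorb[OF u k, of i] that k(1) by (cases "i \<le> k") auto
  then have "S = sg_power f u ` {1..k}"
    using gen generated_singleton[OF u] by auto
  then have bij: "bij_betw (sg_power f u) {1..k} S"
    using inj by (simp add: bij_betw_def)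
  then have "card S = k"
    by (simp add: bij_betw_same_card[symmetric])
  then show ?thesis using u k bij by (simp add: nil_generator_def)
qed

lemma nil_generator_power:
  assumes "nil_generator v n" and "i \<ge> 1"
  shows "sg_power f v i = sg_power f v (min i n)"
  using power_absorb[of v n i] assms by (cases "i \<le> n") (auto simp: nil_generator_def min_def)

lemma nil_generator_generated:
  assumes "nil_generator v n"
  shows "S = generated f {v}"
proof -
  have "v \<in> S" "S = sg_power f v ` {1..n}"
    using assms by (auto simp: nil_generator_def bij_betw_def)
  then show ?thesis
    using generated_singleton[of v] power_in[of v] by fastforce
qed

text \<open>A coincidence of v^k and v^(k+l) with \<open>k < n\<close> would, once
  \<open>k + l\<close> is cut down to at most \<open>n\<close>, identify the powers at two different
  exponents in \<open>{1..n}\<close>.\<close>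

lemma nil_generator_imp_index_period:
  assumes v: "nil_generator v n"
  shows "monogenic_index_period S f n 1"
proof -
  have bij: "bij_betw (sg_power f v) {1..n} S" and n: "n \<ge> 1"
    using v by (auto simp: nil_generator_def)
  have min: "n \<le> k" if "k \<ge> 1" "l \<ge> 1" "sg_power f v k = sg_power f v (k + l)" for k l
  proof (rule ccontr)
    assume "\<not> n \<le> k"
    moreover have "sg_power f v k = sg_power f v (min (k + l) n)"
      using that nil_generator_power[OF v, of "k + l"] by simp
    moreover have "min (k + l) n \<in> {1..n}" "k \<in> {1..n}" "k \<noteq> min (k + l) n"
      using that n \<open>\<not> n \<le> k\<close> by (auto simp: min_def)
    ultimately show False
      using inj_onD[OF bij_betw_imp_inj_on[OF bij]] by blast
  qed
  have "finite S" using bij bij_betw_finite by blast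
  moreover have "sg_power f v n = sg_power f v (n + 1)"
    using v by (simp add: nil_generator_def)
  ultimately show ?thesis
    unfolding monogenic_index_period_def
    using nil_generator_generated[OF v] n min by blast
qed

lemma monogenic_period_1_iff:
  "monogenic_period S f 1 \<longleftrightarrow> (\<exists>v. nil_generator v (card S))"
proof
  assume "monogenic_period S f 1"
  then obtain k u where u: "S = generated f {u}" "k \<ge> 1"
      "sg_power f u k = sg_power f u (k + 1)"
    unfolding monogenic_period_def monogenic_index_period_def by blast
  moreover have "u \<in> S"
    using u(1) generated.base[of u "{u}" f] by simp
  ultimately show "\<exists>v. nil_generator v (card S)"
    using nil_generatorI[of u k] by auto
next
  assume "\<exists>v. nil_generator v (card S)"
  then obtain v where "nil_generator v (card S)" ..
  then have "monogenic_index_period S f (card S) 1"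
    by (rule nil_generator_imp_index_period)
  then show "monogenic_period S f 1"
    unfolding monogenic_period_def ..
qed

lemma nil_generator_set_power:
  assumes v: "nil_generator v n" and "1 \<le> k" and "k \<le> n"
  shows "set_power S f k = sg_power f v ` {k..n}"
  using assms(2,3)
proof (induction k rule: dec_induct)
  case base
  then show ?case using v by (simp add: nil_generator_def bij_betw_def)
next
  case (step k)
  have vS: "v \<in> S" and S: "S = sg_power f v ` {1..n}"
    using v by (auto simp: nil_generator_def bij_betw_def)
  have IH: "set_power S f k = sg_power f v ` {k..n}"
    using step by simp
  show ?case
  proof (intro equalityI subsetI)
    fix z assume "z \<in> set_power S f (Suc k)"
    then obtain x y where z: "z = f x y" and "x \<in> S" and "y \<in> set_power S f k"
      unfolding set_power_Suc[OF step(1)] by blast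
    then obtain i j where ij: "x = sg_power f v i" "i \<ge> 1" "y = sg_power f v j" "j \<ge> k"
      unfolding IH using S by fastforce
    then have "z = sg_power f v (i + j)"
      using power_add[OF vS, of i j] step(1) z by simp
    also have "\<dots> = sg_power f v (min (i + j) n)"
      using ij(2) by (intro nil_generator_power[OF v]) simp
    \<comment> \<open>Since \<open>i\<close> is at least 1 and \<open>j\<close> at least
      \<open>k\<close>, the sum is at least \<open>Suc k\<close>; cutting it at \<open>n\<close>
      preserves this because \<open>Suc k\<close> is at most \<open>n\<close>.\<close>
    finally show "z \<in> sg_power f v ` {Suc k..n}"
      using ij(2,4) step.prems by (intro image_eqI[of _ _ "min (i + j) n"]) simp_all
  next
    fix z assume "z \<in> sg_power f v ` {Suc k..n}"
    then obtain i where i: "z = sg_power f v i" "Suc k \<le> i" "i \<le> n" by auto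
    then have "z = f v (sg_power f v (i - 1))"
      using sg_power_Suc[of "i - 1" f v] step(1) by (cases i) simp_all
    moreover have "i - 1 \<in> {k..n}"
      using i(2,3) by (simp only: atLeastAtMost_iff) linarith
    then have "sg_power f v (i - 1) \<in> set_power S f k"
      unfolding IH by (rule imageI)
    ultimately show "z \<in> set_power S f (Suc k)"
      unfolding set_power_Suc[OF step(1)] using vS by blast
  qed
qed

text \<open>S^(c+1) consists of the powers with exponents c + 1 to \<open>n\<close>, so its size
  \<open>n - c\<close> first becomes 1 at \<open>c = n - 1\<close>.\<close>

lemma nil_generator_imp_coclass_0:
  assumes v: "nil_generator v n"
  shows "nilpotent S f" and "coclass S f = 0"
proof -
  have bij: "bij_betw (sg_power f v) {1..n} S" and n: "n \<ge> 1"
    using v by (auto simp: nil_generator_def)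
  have card_pow: "card (set_power S f (c + 1)) = n - c" if "c < n" for c
  proof -
    have "inj_on (sg_power f v) {c + 1..n}"
      using bij_betw_imp_inj_on[OF bij] by (rule inj_on_subset) auto
    then show ?thesis
      using that nil_generator_set_power[OF v, of "c + 1"] by (simp add: card_image)
  qed
  have last: "card (set_power S f (n - 1 + 1)) = 1"
    using card_pow[of "n - 1"] n by simp
  then show "nilpotent S f"
    unfolding nilpotent_def by blast
  have "nilpotency_class S f = n - 1"
    unfolding nilpotency_class_def
  proof (rule Least_equality)
    show "card (set_power S f (n - 1 + 1)) = 1" by (rule last)
    show "n - 1 \<le> c" if "card (set_power S f (c + 1)) = 1" for c
      using card_pow[of c] that by (cases "c < n") auto
  qed
  moreover have "card S = n"
    using bij_betw_same_card[OF bij] by simp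
  ultimately show "coclass S f = 0"
    using n by (simp add: coclass_def of_nat_diff)
qed

text \<open>Addition truncated at \<open>n\<close> is the concrete model: the exponent map is an
  isomorphism from it, and conversely the image of 1 under any isomorphism is a generator of the
  required kind.\<close>

lemma nil_generator_iff_isomorphic:
  assumes "n \<ge> 1"
  shows "(\<exists>v. nil_generator v n) \<longleftrightarrow> sg_isomorphic {1..n} (\<lambda>i j. min (i + j) n) S f"
proof
  assume "\<exists>v. nil_generator v n"
  then obtain v where v: "nil_generator v n" by blast
  then have "sg_power f v (min (i + j) n) = f (sg_power f v i) (sg_power f v j)"
    if "i \<in> {1..n}" "j \<in> {1..n}" for i j
    using that nil_generator_power[OF v, of "i + j"] power_add[of v i j]
    by (simp add: nil_generator_def)
  then show "sg_isomorphic {1..n} (\<lambda>i j. min (i + j) n) S f"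
    unfolding sg_isomorphic_def using v by (auto simp: nil_generator_def)
next
  assume "sg_isomorphic {1..n} (\<lambda>i j. min (i + j) n) S f"
  then obtain p where bij: "bij_betw p {1..n} S"
    and p: "\<And>i j. i \<in> {1..n} \<Longrightarrow> j \<in> {1..n} \<Longrightarrow> p (min (i + j) n) = f (p i) (p j)"
    unfolding sg_isomorphic_def by blast
  have pow: "p i = sg_power f (p 1) i" if "1 \<le> i" "i \<le> n" for i
    using that
  proof (induction i rule: dec_induct)
    case (step i)
    then show ?case
      using p[of 1 i] by (simp add: sg_power_Suc min_def)
  qed simp
  have "bij_betw p {1..n} S \<longleftrightarrow> bij_betw (sg_power f (p 1)) {1..n} S"
    by (intro bij_betw_cong pow) simp_all
  with bij have "bij_betw (sg_power f (p 1)) {1..n} S" by blast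
  moreover have "p 1 \<in> S"
    using bij assms by (auto simp: bij_betw_def)
  \<comment> \<open>The sum 1 + n is cut back to \<open>n\<close>, so \<open>p n\<close> absorbs
    \<open>p 1\<close>.\<close>
  moreover have "sg_power f (p 1) n = sg_power f (p 1) (Suc n)"
    using p[of 1 n] pow[of n] assms by (simp add: sg_power_Suc)
  ultimately show "\<exists>v. nil_generator v n"
    using assms unfolding nil_generator_def by blast
qed

end

section \<open>The presented semigroup\<close>

lemma free_semigroup_singleton:
  "free_semigroup {u} = {replicate i u | i. i \<ge> 1}"
proof (intro equalityI subsetI)
  fix w assume "w \<in> free_semigroup {u}"
  then have "\<forall>x\<in>set w. x = u" "length w \<ge> 1"
    by (auto simp: free_semigroup_def Suc_le_eq)
  then have "w = replicate (length w) u" "length w \<ge> 1"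
    by (simp_all only: replicate_length_same)
  then show "w \<in> {replicate i u | i. i \<ge> 1}" by blast
qed (auto simp: free_semigroup_def)

text \<open>Equality of the minima encodes that the lengths are equal or both at least
  \<open>n\<close>, in a form that linear arithmetic handles directly.\<close>

definition truncated_congruence :: "'x \<Rightarrow> nat \<Rightarrow> ('x list \<times> 'x list) set" where
  "truncated_congruence u n =
     {(replicate i u, replicate j u) | i j. i \<ge> 1 \<and> j \<ge> 1 \<and> min i n = min j n}"

lemma truncated_congruence_iff [simp]:
  "(replicate i u, replicate j u) \<in> truncated_congruence u n
     \<longleftrightarrow> i \<ge> 1 \<and> j \<ge> 1 \<and> min i n = min j n"
  by (auto simp: truncated_congruence_def)

lemma congruence_on_truncated_congruence:
  "congruence_on (free_semigroup {u}) (@) (truncated_congruence u n)"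
  unfolding congruence_on_def
proof (intro conjI allI impI equivI)
  show "truncated_congruence u n \<subseteq> free_semigroup {u} \<times> free_semigroup {u}"
    by (auto simp: truncated_congruence_def free_semigroup_singleton)
  show "refl_on (free_semigroup {u}) (truncated_congruence u n)"
    by (auto simp: refl_on_def free_semigroup_singleton)
  show "sym (truncated_congruence u n)"
    by (auto simp: sym_def truncated_congruence_def)
  show "trans (truncated_congruence u n)"
    by (auto simp: trans_def truncated_congruence_def)
  fix a b c d
  assume "(a, b) \<in> truncated_congruence u n" "(c, d) \<in> truncated_congruence u n"
  then obtain i j k l where "a = replicate i u" "b = replicate j u" "c = replicate k u"
      "d = replicate l u" "i \<ge> 1" "j \<ge> 1" "k \<ge> 1" "l \<ge> 1" "min i n = min j n" "min k n = min l n"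
    unfolding truncated_congruence_def by blast
  moreover from this have "min (i + k) n = min (j + l) n"
    by linarith
  ultimately show "(a @ c, b @ d) \<in> truncated_congruence u n"
    by (simp flip: replicate_add)
qed

text \<open>The truncated congruence contains the defining pair. Conversely, any congruence with
  that pair links u^n to every longer word, hence all words of length at least \<open>n\<close> to
  one another.\<close>

lemma generated_congruence_truncated:
  assumes "n \<ge> 1"
  shows "generated_congruence (free_semigroup {u}) (@) {(replicate n u, replicate (n + 1) u)}
    = truncated_congruence u n"
proof (intro equalityI)
  show "generated_congruence (free_semigroup {u}) (@) {(replicate n u, replicate (n + 1) u)}
    \<subseteq> truncated_congruence u n"
    unfolding generated_congruence_def
    using congruence_on_truncated_congruence[of u n] assms
      truncated_congruence_iff[of n u "n + 1" n]
    by (intro Inter_lower) auto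
  have "truncated_congruence u n \<subseteq> r"
    if r: "congruence_on (free_semigroup {u}) (@) r"
      and rel: "(replicate n u, replicate (n + 1) u) \<in> r" for r
  proof -
    have equiv: "equiv (free_semigroup {u}) r"
      and cong: "\<And>a b c d. (a, b) \<in> r \<Longrightarrow> (c, d) \<in> r \<Longrightarrow> (a @ c, b @ d) \<in> r"
      using r unfolding congruence_on_def by blast+
    have refl: "(replicate i u, replicate i u) \<in> r" if "i \<ge> 1" for i
      using equiv that by (auto simp: equiv_def refl_on_def free_semigroup_singleton)
    have up: "(replicate n u, replicate (n + k) u) \<in> r" for k
    proof (induction k)
      case 0
      show ?case using refl assms by simp
    next
      case (Suc k)
      \<comment> \<open>Appending one letter shifts the induction hypothesis to start at length n +
        1; the defining pair bridges from \<open>n\<close> to n + 1.\<close>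
      have "(replicate n u @ replicate 1 u, replicate (n + k) u @ replicate 1 u) \<in> r"
        using cong[OF Suc refl[of 1]] by simp
      then have "(replicate (n + 1) u, replicate (n + Suc k) u) \<in> r"
        by (simp only: replicate_add[symmetric]) simp
      then show ?case
        using rel equiv unfolding equiv_def by (meson transD)
    qed
    have "(replicate i u, replicate j u) \<in> r" if "i \<ge> 1" "j \<ge> 1" "min i n = min j n" for i j
    proof (cases "i = j")
      case False
      \<comment> \<open>Different lengths with equal minima must both have been truncated.\<close>
      then have "n \<le> i" "n \<le> j"
        using that by (auto simp: min_def split: if_splits)
      then have "(replicate n u, replicate i u) \<in> r" "(replicate n u, replicate j u) \<in> r"
        using up[of "i - n"] up[of "j - n"] by simp_all
      then show ?thesis
        using equiv unfolding equiv_def by (meson symD transD)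
    qed (use refl that in simp)
    then show ?thesis by (auto simp: truncated_congruence_def)
  qed
  then show "truncated_congruence u n
    \<subseteq> generated_congruence (free_semigroup {u}) (@) {(replicate n u, replicate (n + 1) u)}"
    unfolding generated_congruence_def by (intro Inter_greatest) auto
qed

lemma isomorphic_quotient_truncated:
  assumes "n \<ge> 1"
  shows "sg_isomorphic {1..n} (\<lambda>i j. min (i + j) n)
    (free_semigroup {u} // truncated_congruence u n)
    (quotient_mult (@) (truncated_congruence u n))"
proof -
  let ?\<rho> = "truncated_congruence u n"
  define cls where "cls i = ?\<rho> `` {replicate i u}" for i
  have equiv: "equiv (free_semigroup {u}) ?\<rho>"
    using congruence_on_truncated_congruence[of u n] unfolding congruence_on_def ..
  have cls_eq: "cls i = cls j \<longleftrightarrow> min i n = min j n" if "i \<ge> 1" "j \<ge> 1" for i j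
    unfolding cls_def using that
    by (subst eq_equiv_class_iff[OF equiv]) (auto simp: free_semigroup_singleton)
  have cls_min: "cls i = cls (min i n)" if "i \<ge> 1" for i
    using cls_eq[of i "min i n"] that assms by simp
  have "inj_on cls {1..n}"
    by (auto simp: inj_on_def cls_eq)
  moreover have "cls ` {1..n} = free_semigroup {u} // ?\<rho>"
  proof -
    have "free_semigroup {u} // ?\<rho> = cls ` {1..}"
      by (auto simp: quotient_def cls_def free_semigroup_singleton)
    moreover have "cls ` {1..} = cls ` {1..n}"
    proof (intro equalityI subsetI)
      fix x assume "x \<in> cls ` {1..}"
      then obtain i where "x = cls i" "i \<ge> 1" by auto
      then have "x = cls (min i n)" "min i n \<in> {1..n}"
        using cls_min[of i] assms by simp_all
      then show "x \<in> cls ` {1..n}" by blast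
    qed auto
    ultimately show ?thesis by simp
  qed
  ultimately have "bij_betw cls {1..n} (free_semigroup {u} // ?\<rho>)"
    by (simp add: bij_betw_def)
  moreover have "cls (min (i + j) n) = quotient_mult (@) ?\<rho> (cls i) (cls j)"
    if "i \<in> {1..n}" "j \<in> {1..n}" for i j
  proof -
    \<comment> \<open>All members of the union defining \<open>quotient_mult\<close> are the same
      class.\<close>
    have "?\<rho> `` {a @ b} = cls (i + j)" if "a \<in> cls i" "b \<in> cls j" for a b
    proof -
      have "(replicate i u @ replicate j u, a @ b) \<in> ?\<rho>"
        using that congruence_on_truncated_congruence[of u n]
        unfolding congruence_on_def cls_def by blast
      then show ?thesis
        using equiv_class_eq[OF equiv] by (simp add: cls_def replicate_add)
    qed
    \<comment> \<open>These representatives make both index sets nonempty, so the union is that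
      common class and not the empty set.\<close>
    moreover have "replicate i u \<in> cls i" "replicate j u \<in> cls j"
      using that by (simp_all add: cls_def)
    ultimately have "quotient_mult (@) ?\<rho> (cls i) (cls j) = cls (i + j)"
      unfolding quotient_mult_def by blast
    then show ?thesis using cls_min[of "i + j"] that by simp
  qed
  ultimately show ?thesis
    unfolding sg_isomorphic_def by blast
qed

text \<open>The presented semigroup is isomorphic to truncated addition on \<open>{1..n}\<close>, so
  it can be replaced by that model through symmetry and transitivity.\<close>

lemma is_presentation_iff_isomorphic:
  assumes "semigroup_on S f" and "n \<ge> 1"
  shows "is_presentation {u} {(replicate n u, replicate (n + 1) u)} S f
    \<longleftrightarrow> sg_isomorphic {1..n} (\<lambda>i j. min (i + j) n) S f"
proof -
  let ?\<rho> = "truncated_congruence u n"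
  let ?Q = "free_semigroup {u} // ?\<rho>"
  have "{(replicate n u, replicate (n + 1) u)} \<subseteq> free_semigroup {u} \<times> free_semigroup {u}"
    unfolding free_semigroup_def using assms(2) by auto
  then have "is_presentation {u} {(replicate n u, replicate (n + 1) u)} S f
      \<longleftrightarrow> sg_isomorphic S f ?Q (quotient_mult (@) ?\<rho>)"
    unfolding is_presentation_def generated_congruence_truncated[OF assms(2)] Let_def by blast
  also have "\<dots> \<longleftrightarrow> sg_isomorphic {1..n} (\<lambda>i j. min (i + j) n) S f"
  proof
    assume "sg_isomorphic S f ?Q (quotient_mult (@) ?\<rho>)"
    then have "sg_isomorphic ?Q (quotient_mult (@) ?\<rho>) S f"
      using semigroup_on.closed[OF assms(1)] by (rule sg_isomorphic_sym)
    with isomorphic_quotient_truncated[OF assms(2)]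
    show "sg_isomorphic {1..n} (\<lambda>i j. min (i + j) n) S f"
      by (rule sg_isomorphic_trans)
  next
    assume "sg_isomorphic {1..n} (\<lambda>i j. min (i + j) n) S f"
    then have "sg_isomorphic S f {1..n} (\<lambda>i j. min (i + j) n)"
      by (rule sg_isomorphic_sym) (use assms(2) in auto)
    then show "sg_isomorphic S f ?Q (quotient_mult (@) ?\<rho>)"
      using isomorphic_quotient_truncated[OF assms(2)] by (rule sg_isomorphic_trans)
  qed
  finally show ?thesis .
qed

section \<open>Reduction of each condition to the existence of a nil generator\<close>

theorem lemma2p3:
  fixes S :: "'a set" and f :: "'a \<Rightarrow> 'a \<Rightarrow> 'a" and n :: nat and u :: 'x
  assumes "semigroup_on S f"
    and "card S = n" and "n \<ge> 1"
  shows "(nilpotent S f \<and> coclass S f = 0 \<longleftrightarrow> monogenic S f \<and> nilpotent S f)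
       \<and> (monogenic S f \<and> nilpotent S f \<longleftrightarrow> monogenic_period S f 1)
       \<and> (monogenic_period S f 1 \<longleftrightarrow>
            is_presentation {u} {(replicate n u, replicate (n + 1) u)} S f)"
proof -
  interpret semigroup_on S f by fact
  \<comment> \<open>An infinite set has \<open>card\<close> 0, which \<open>n \<ge> 1\<close>
    excludes.\<close>
  have fin: "finite S"
    using assms(2,3) card.infinite by fastforce
  have iii: "monogenic_period S f 1 \<longleftrightarrow> (\<exists>v. nil_generator v n)"
    using monogenic_period_1_iff assms(2) by simp
  \<comment> \<open>Shared by (i) and (ii): each yields nilpotency and a single generator.\<close>
  have gen: "\<exists>v. nil_generator v n"
    if nil: "nilpotent S f" and v: "v \<in> S" "S = generated f {v}" for v
  proof -
    obtain m where "m \<ge> 1" "sg_power f v m = sg_power f v (Suc m)"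
      using nilpotent_power_stable[OF nil v(1)] .
    then have "nil_generator v n"
      unfolding assms(2)[symmetric] by (rule nil_generatorI[OF v])
    then show ?thesis ..
  qed
  have "\<exists>v. nil_generator v n" if nil: "nilpotent S f" and coclass: "coclass S f = 0"
  proof -
    obtain v where "v \<in> S" "S = generated f {v}"
      using coclass_0_generator[OF fin nil coclass] .
    then show ?thesis by (rule gen[OF nil])
  qed
  then have i: "nilpotent S f \<and> coclass S f = 0 \<longleftrightarrow> (\<exists>v. nil_generator v n)"
    using nil_generator_imp_coclass_0 by blast
  have "\<exists>v. nil_generator v n" if mono: "monogenic S f" and nil: "nilpotent S f"
  proof -
    obtain v where v: "S = generated f {v}"
      using mono unfolding monogenic_def monogenic_index_period_def by blast
    moreover have "v \<in> S"
      using v generated.base[of v "{v}" f] by simp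
    ultimately show ?thesis by (intro gen[OF nil])
  qed
  \<comment> \<open>For the converse in (ii), a nil generator gives monogenicity through
    \<open>iii\<close> and nilpotency through \<open>i\<close>.\<close>
  moreover have "monogenic S f" if "monogenic_period S f 1"
    using that by (auto simp: monogenic_def monogenic_period_def)
  ultimately have ii: "monogenic S f \<and> nilpotent S f \<longleftrightarrow> (\<exists>v. nil_generator v n)"
    using i iii by blast
  have "is_presentation {u} {(replicate n u, replicate (n + 1) u)} S f
      \<longleftrightarrow> (\<exists>v. nil_generator v n)"
    using is_presentation_iff_isomorphic[OF assms(1,3)] nil_generator_iff_isomorphic[OF assms(3)]
    by simp
  then show ?thesis using i ii iii by blast
qed

end
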